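(* Let $\mathbb{F}$ be an arbitrary field, let $D,d$ be positive integers, let $X=\mathbb{F}^d$, and let $V_D$ be the family of all zero sets $Z(f)=\{x\in\mathbb{F}^d: f(x)=0\}$ of polynomials $f\in\mathbb{F}[x_1,\ldots,x_d]$ of degree at most $D$. Then $$\eta(X,V_D)\leq\binom{D+d}{d}.$$
   Context: For a set $X$ and a family $\mathscr{F}$ of subsets of $X$, the colorful Helly number $\eta(X,\mathscr{F})$ is the minimum positive integer $\eta$ for which the following holds: whenever finite subfamilies $\mathscr{F}_1,\ldots,\mathscr{F}_\eta\subset\mathscr{F}$ (not necessarily distinct) satisfy $\bigcap_{F\in\mathscr{F}_i}F=\emptyset$ for every $i=1,\ldots,\eta$, there exist $F_i\in\mathscr{F}_i$ ($1\le i\le\eta$) such that $F_1\cap\cdots\cap F_\eta=\emptyset$ (and $\eta(X,\mathscr{F})=\infty$ if no such integer exists). The intersection of an empty subfamily is understood to be $X$. *)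

theory Defs
  imports
    "HOL-Analysis.Finite_Cartesian_Product"
    "HOL-Library.Poly_Mapping"
    "HOL-Library.Extended_Nat"
begin

text \<open>
  Formal polynomials with coefficients in \<open>'a\<close> and variables indexed by \<open>'n\<close>: a monomial is a
  finitely supported exponent vector, a polynomial a finitely supported map from monomials to
  coefficients.
\<close>

type_synonym ('n, 'a) mvpoly = "('n \<Rightarrow>\<^sub>0 nat) \<Rightarrow>\<^sub>0 'a"

definition monom_degree :: "('n::finite \<Rightarrow>\<^sub>0 nat) \<Rightarrow> nat" where
  "monom_degree m = (\<Sum>i\<in>UNIV. Poly_Mapping.lookup m i)"

text \<open>The zero polynomial gets degree \<open>0\<close>, so it has degree at most \<open>D\<close> for every \<open>D\<close>.\<close>

definition total_degree :: "('n::finite, 'a::zero) mvpoly \<Rightarrow> nat" where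
  "total_degree p = Max (insert 0 (monom_degree ` Poly_Mapping.keys p))"

definition eval_mvpoly :: "('n::finite, 'a::comm_semiring_1) mvpoly \<Rightarrow> 'a ^ 'n \<Rightarrow> 'a" where
  "eval_mvpoly p x =
     (\<Sum>m\<in>Poly_Mapping.keys p. Poly_Mapping.lookup p m * (\<Prod>i\<in>UNIV. (x $ i) ^ Poly_Mapping.lookup m i))"

definition zero_set :: "('n::finite, 'a::comm_semiring_1) mvpoly \<Rightarrow> ('a ^ 'n) set" where
  "zero_set p = {x. eval_mvpoly p x = 0}"

definition zero_sets_upto :: "nat \<Rightarrow> ('a::comm_semiring_1 ^ 'n::finite) set set" where
  "zero_sets_upto D = {zero_set p |p. total_degree p \<le> D}"

text \<open>
  Intersecting with \<open>X\<close> makes the intersection of the empty subfamily equal to \<open>X\<close>; for nonempty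
  families of subsets of \<open>X\<close> it changes nothing.
\<close>

definition colorful_helly_property :: "'x set \<Rightarrow> 'x set set \<Rightarrow> nat \<Rightarrow> bool" where
  "colorful_helly_property X \<F> k \<longleftrightarrow>
     (\<forall>\<G> :: nat \<Rightarrow> 'x set set.
        (\<forall>i\<in>{1..k}. finite (\<G> i) \<and> \<G> i \<subseteq> \<F> \<and> X \<inter> \<Inter>(\<G> i) = {}) \<longrightarrow>
        (\<exists>F. (\<forall>i\<in>{1..k}. F i \<in> \<G> i) \<and> X \<inter> (\<Inter>i\<in>{1..k}. F i) = {}))"

text \<open>In \<^typ>\<open>enat\<close>, the infimum of a nonempty set is its minimum and \<open>Inf {} = \<infinity>\<close>.\<close>

definition colorful_helly_number :: "'x set \<Rightarrow> 'x set set \<Rightarrow> enat" where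
  "colorful_helly_number X \<F> = Inf {enat k |k. 0 < k \<and> colorful_helly_property X \<F> k}"

end

theory Submission
  imports Defs "HOL-Library.Function_Algebras"
begin

text \<open>
  Zero sets of polynomials of degree at most \<open>D\<close> are zero sets of functions from a vector space
  that is spanned by the monomial functions of degree at most \<open>D\<close>. There are at most
  \<open>(D + d) choose d\<close> of these, and one of them is the constant \<open>1\<close>.

  The colorful property then follows greedily from linear algebra
  (\<open>colorful_helly_property_zero_sets\<close>). Pick \<open>f\<^sub>1, f\<^sub>2, \<dots>\<close> one colour at a time, each outside the
  span of its predecessors. If no such \<open>f\<^sub>k\<close> exists, every member of the \<open>k\<close>-th subfamily is the
  zero set of a combination of \<open>f\<^sub>1, \<dots>, f\<^sub>k\<^sub>-\<^sub>1\<close>, so it contains their common zeros; as the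
  \<open>k\<close>-th subfamily has empty intersection, there are no common zeros, and the remaining choices are
  arbitrary. If the choices never get stuck, they yield as many independent functions as there are
  spanning monomial functions. The chosen functions then span the whole space, so \<open>1\<close> is a
  combination of them, and again they have no common zero.
\<close>

section \<open>Colorful Helly numbers of zero sets in a function space\<close>

interpretation function_space: vector_space "\<lambda>(c::'a::field) (f::'x \<Rightarrow> 'a) x. c * f x"
  by unfold_locales (auto simp: fun_eq_iff algebra_simps)

lemma sum_fun_apply: "(\<Sum>i\<in>A. f i) x = (\<Sum>i\<in>A. f i x)"
  by (induction A rule: infinite_finite_induct) auto

lemma span_vanishes_at_common_zero:
  fixes S :: "('x \<Rightarrow> 'a::field) set"
  assumes "g \<in> function_space.span S" and "\<And>f. f \<in> S \<Longrightarrow> f x = 0"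
  shows "g x = 0"
  using assms(1)
  by (induction rule: function_space.span_induct_alt) (auto simp: assms(2))

text \<open>
  Once the functions chosen so far have no common zero, any further choice keeps it that way. So
  the induction needs a new independent function only while a common zero \<open>x\<close> exists, and then a
  member of the next subfamily that misses \<open>x\<close> provides it.
\<close>

lemma greedy_choice:
  fixes U :: "('x \<Rightarrow> 'a::field) set" and \<G> :: "nat \<Rightarrow> 'x set set"
  assumes sub: "\<And>i. i \<in> {1..n} \<Longrightarrow> \<G> i \<subseteq> {{x. f x = 0} |f. f \<in> U}"
    and empty: "\<And>i. i \<in> {1..n} \<Longrightarrow> \<Inter>(\<G> i) = {}"
  shows "\<exists>f. (\<forall>i\<in>{1..n}. f i \<in> U \<and> {x. f i x = 0} \<in> \<G> i) \<and>
           ((\<Inter>i\<in>{1..n}. {x. f i x = 0}) = {} \<or>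
            inj_on f {1..n} \<and> function_space.independent (f ` {1..n}))"
  using assms
proof (induction n)
  case 0
  then show ?case by (simp add: function_space.dependent_def)
next
  case (Suc n)
  have "\<exists>f. (\<forall>i\<in>{1..n}. f i \<in> U \<and> {x. f i x = 0} \<in> \<G> i) \<and>
           ((\<Inter>i\<in>{1..n}. {x. f i x = 0}) = {} \<or>
            inj_on f {1..n} \<and> function_space.independent (f ` {1..n}))"
    by (rule Suc.IH) (use Suc.prems in auto)
  then obtain f where f: "\<And>i. i \<in> {1..n} \<Longrightarrow> f i \<in> U \<and> {x. f i x = 0} \<in> \<G> i"
    and alt: "(\<Inter>i\<in>{1..n}. {x. f i x = 0}) = {} \<or>
              inj_on f {1..n} \<and> function_space.independent (f ` {1..n})"
    by blast
  have sub: "\<G> (Suc n) \<subseteq> {{x. f x = 0} |f. f \<in> U}" and empty: "\<Inter>(\<G> (Suc n)) = {}"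
    using Suc.prems by auto
  have interval: "{1..Suc n} = insert (Suc n) {1..n}" by auto
  have "\<exists>g. g \<in> U \<and> {x. g x = 0} \<in> \<G> (Suc n) \<and>
          ((\<Inter>i\<in>{1..n}. {x. f i x = 0}) = {} \<or> g \<notin> function_space.span (f ` {1..n}))"
  proof (cases "(\<Inter>i\<in>{1..n}. {x. f i x = 0}) = {}")
    case True
    have "\<G> (Suc n) \<noteq> {}" using empty by auto
    with True sub show ?thesis by blast
  next
    case False
    then obtain x where x: "\<forall>i\<in>{1..n}. f i x = 0" by blast
    from empty obtain A where A: "A \<in> \<G> (Suc n)" "x \<notin> A" by blast
    with sub obtain g where g: "g \<in> U" "A = {x. g x = 0}" by blast
    have "g \<notin> function_space.span (f ` {1..n})"
      using span_vanishes_at_common_zero[of g "f ` {1..n}" x] x A(2) g(2) by auto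
    with A g show ?thesis by blast
  qed
  then obtain g where g: "g \<in> U" "{x. g x = 0} \<in> \<G> (Suc n)"
    and new: "(\<Inter>i\<in>{1..n}. {x. f i x = 0}) = {} \<or> g \<notin> function_space.span (f ` {1..n})"
    by blast
  define f' where "f' = f(Suc n := g)"
  have old: "f' i = f i" if "i \<in> {1..n}" for i using that by (simp add: f'_def)
  have last: "f' (Suc n) = g" by (simp add: f'_def)
  have image: "f' ` {1..n} = f ` {1..n}" using old by auto
  have "f' i \<in> U \<and> {x. f' i x = 0} \<in> \<G> i" if "i \<in> {1..Suc n}" for i
    using that f g old last unfolding interval by auto
  moreover have "(\<Inter>i\<in>{1..Suc n}. {x. f' i x = 0}) = {} \<or>
      inj_on f' {1..Suc n} \<and> function_space.independent (f' ` {1..Suc n})"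
  proof (cases "(\<Inter>i\<in>{1..n}. {x. f i x = 0}) = {}")
    case True
    have "(\<Inter>i\<in>{1..Suc n}. {x. f' i x = 0}) \<subseteq> (\<Inter>i\<in>{1..n}. {x. f i x = 0})"
      unfolding interval using old by auto
    with True show ?thesis by blast
  next
    case False
    with alt new have inj: "inj_on f {1..n}" and ind: "function_space.independent (f ` {1..n})"
      and out: "g \<notin> function_space.span (f ` {1..n})" by auto
    have "g \<notin> f ` {1..n}" using out function_space.span_base by blast
    moreover have "inj_on f' {1..n}" using inj old inj_on_cong[of "{1..n}" f' f] by blast
    ultimately have "inj_on f' {1..Suc n}"
      unfolding interval using last image by auto
    moreover have "function_space.independent (f' ` {1..Suc n})"
      unfolding interval using function_space.independent_insertI[OF out ind] last image by simp
    ultimately show ?thesis by blast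
  qed
  ultimately show ?case by blast
qed

lemma colorful_helly_property_zero_sets:
  fixes B :: "('x \<Rightarrow> 'a::field) set"
  assumes "finite B" and one: "(\<lambda>_. 1) \<in> function_space.span B"
    and \<F>: "\<F> \<subseteq> {{x. f x = 0} |f. f \<in> function_space.span B}"
  shows "colorful_helly_property UNIV \<F> (card B)"
  unfolding colorful_helly_property_def
proof (intro allI impI)
  fix \<G> :: "nat \<Rightarrow> 'x set set"
  assume \<G>: "\<forall>i\<in>{1..card B}. finite (\<G> i) \<and> \<G> i \<subseteq> \<F> \<and> UNIV \<inter> \<Inter>(\<G> i) = {}"
  let ?I = "{1..card B}"
  have "\<exists>f. (\<forall>i\<in>?I. f i \<in> function_space.span B \<and> {x. f i x = 0} \<in> \<G> i) \<and>
           ((\<Inter>i\<in>?I. {x. f i x = 0}) = {} \<or>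
            inj_on f ?I \<and> function_space.independent (f ` ?I))"
  proof (rule greedy_choice)
    show "\<G> i \<subseteq> {{x. f x = 0} |f. f \<in> function_space.span B}" if "i \<in> ?I" for i
      using \<G> \<F> that by (meson order_trans)
    show "\<Inter>(\<G> i) = {}" if "i \<in> ?I" for i
      using \<G> that by auto
  qed
  then obtain f where f: "\<forall>i\<in>?I. f i \<in> function_space.span B \<and> {x. f i x = 0} \<in> \<G> i"
    and alt: "(\<Inter>i\<in>?I. {x. f i x = 0}) = {} \<or>
              inj_on f ?I \<and> function_space.independent (f ` ?I)"
    by blast
  have "(\<Inter>i\<in>?I. {x. f i x = 0}) = {}"
  proof (rule ccontr)
    assume nonempty: "(\<Inter>i\<in>?I. {x. f i x = 0}) \<noteq> {}"
    with alt have inj: "inj_on f ?I" and ind: "function_space.independent (f ` ?I)" by auto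
    from nonempty obtain x where x: "\<forall>i\<in>?I. f i x = 0" by blast
    \<comment> \<open>A common zero makes \<open>1\<close> independent of the \<open>f i\<close>; together these are \<open>card B + 1\<close> functions.\<close>
    have out: "(\<lambda>_. 1) \<notin> function_space.span (f ` ?I)"
      using span_vanishes_at_common_zero[of "\<lambda>_. 1" "f ` ?I" x] x by auto
    have "card (insert (\<lambda>_. 1) (f ` ?I)) \<le> card B"
      using function_space.independent_span_bound[OF \<open>finite B\<close>
          function_space.independent_insertI[OF out ind]] f one by auto
    moreover have "(\<lambda>_. 1) \<notin> f ` ?I" using out function_space.span_base by blast
    ultimately show False using card_image[OF inj] by simp
  qed
  with f show "\<exists>F. (\<forall>i\<in>?I. F i \<in> \<G> i) \<and> UNIV \<inter> (\<Inter>i\<in>?I. F i) = {}"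
    by (intro exI[of _ "\<lambda>i. {x. f i x = 0}"]) auto
qed

section \<open>Monomials of bounded degree\<close>

definition monomials_upto :: "nat \<Rightarrow> ('n::finite \<Rightarrow>\<^sub>0 nat) set" where
  "monomials_upto D = {m. monom_degree m \<le> D}"

definition eval_monom :: "('n::finite \<Rightarrow>\<^sub>0 nat) \<Rightarrow> 'a::comm_semiring_1 ^ 'n \<Rightarrow> 'a" where
  "eval_monom m x = (\<Prod>i\<in>UNIV. (x $ i) ^ Poly_Mapping.lookup m i)"

text \<open>
  Stars and bars: the slack \<open>D - monom_degree m\<close>, prepended to the list of exponents, turns the
  degree bound into a sum of \<open>CARD('n) + 1\<close> naturals that is exactly \<open>D\<close>.
\<close>

lemma monomials_upto_bound:
  "finite (monomials_upto D :: ('n::finite \<Rightarrow>\<^sub>0 nat) set)"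
  "card (monomials_upto D :: ('n \<Rightarrow>\<^sub>0 nat) set) \<le> (D + CARD('n)) choose CARD('n)"
proof -
  obtain xs :: "'n list" where xs: "set xs = UNIV" "distinct xs"
    using finite_distinct_list[of "UNIV :: 'n set"] by auto
  have len: "length xs = CARD('n)" using xs distinct_card by force
  let ?L = "{l::nat list. length l = CARD('n) + 1 \<and> sum_list l = D}"
  define h where "h = (\<lambda>m. (D - monom_degree m) # map (Poly_Mapping.lookup m) xs)"
  have inj: "inj_on h (monomials_upto D)"
    using xs by (auto simp: h_def inj_on_def poly_mapping_eq_iff fun_eq_iff)
  have "sum_list (map (Poly_Mapping.lookup m) xs) = monom_degree m" for m
    using xs by (simp add: monom_degree_def sum_list_distinct_conv_sum_set)
  then have im: "h ` monomials_upto D \<subseteq> ?L"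
    by (auto simp: h_def monomials_upto_def len)
  have card: "card ?L = (D + CARD('n)) choose D"
    using card_length_sum_list[of "CARD('n) + 1" D] by simp
  have "card ?L > 0" unfolding card by simp
  then have fin: "finite ?L" by (rule card_ge_0_finite)
  show "finite (monomials_upto D :: ('n \<Rightarrow>\<^sub>0 nat) set)"
    using inj im fin by (rule inj_on_finite)
  show "card (monomials_upto D :: ('n \<Rightarrow>\<^sub>0 nat) set) \<le> (D + CARD('n)) choose CARD('n)"
    using card_inj_on_le[OF inj im fin] card binomial_symmetric[of D "D + CARD('n)"] by simp
qed

lemma keys_subset_monomials_upto:
  "total_degree p \<le> D \<Longrightarrow> Poly_Mapping.keys p \<subseteq> monomials_upto D"
  by (auto simp: total_degree_def monomials_upto_def)

lemma eval_mvpoly_in_span: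
  fixes p :: "('n::finite, 'a::field) mvpoly"
  assumes "total_degree p \<le> D"
  shows "eval_mvpoly p \<in> function_space.span (eval_monom ` monomials_upto D)"
proof -
  have "eval_mvpoly p =
      (\<Sum>m\<in>Poly_Mapping.keys p. (\<lambda>x. Poly_Mapping.lookup p m * eval_monom m x))"
    by (simp add: fun_eq_iff eval_mvpoly_def eval_monom_def sum_fun_apply)
  also have "\<dots> \<in> function_space.span (eval_monom ` monomials_upto D)"
    using keys_subset_monomials_upto[OF assms]
    by (intro function_space.span_sum function_space.span_scale function_space.span_base) auto
  finally show ?thesis .
qed

theorem mainTheorem7:
  fixes D :: nat
  assumes "0 < D"
  shows "colorful_helly_number (UNIV :: ('a::field ^ 'd::finite) set) (zero_sets_upto D)
           \<le> enat ((D + CARD('d)) choose CARD('d))"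
proof -
  let ?M = "monomials_upto D :: ('d \<Rightarrow>\<^sub>0 nat) set"
  let ?B = "eval_monom ` ?M :: ('a ^ 'd \<Rightarrow> 'a) set"
  have fin: "finite ?B" using monomials_upto_bound(1) by blast
  have "eval_monom 0 = (\<lambda>_ :: 'a ^ 'd. 1)" by (simp add: eval_monom_def fun_eq_iff)
  moreover have "0 \<in> ?M" by (simp add: monomials_upto_def monom_degree_def)
  ultimately have one: "(\<lambda>_. 1) \<in> ?B" by (metis imageI)
  have "colorful_helly_property (UNIV :: ('a ^ 'd) set) (zero_sets_upto D) (card ?B)"
  proof (rule colorful_helly_property_zero_sets[OF fin])
    show "(\<lambda>_. 1) \<in> function_space.span ?B" using one by (rule function_space.span_base)
    show "zero_sets_upto D \<subseteq> {{x. f x = 0} |f. f \<in> function_space.span ?B}"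
      using eval_mvpoly_in_span by (fastforce simp: zero_sets_upto_def zero_set_def)
  qed
  moreover have "0 < card ?B" using fin one by (auto simp: card_gt_0_iff)
  ultimately have "colorful_helly_number (UNIV :: ('a ^ 'd) set) (zero_sets_upto D) \<le> enat (card ?B)"
    unfolding colorful_helly_number_def by (intro Inf_lower) blast
  also have "card ?B \<le> (D + CARD('d)) choose CARD('d)"
    using card_image_le[OF monomials_upto_bound(1)] monomials_upto_bound(2) by (rule order_trans)
  finally show ?thesis by simp
qed

end
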